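(* Let $\mathcal{X}$ be a real normed linear space, $\varphi_1,\ldots,\varphi_n\in\mathcal{X}^*$, $\xi\in\mathbb{R}^n$, and let $w_1,\ldots,w_n>0$. Let $h_1,\ldots,h_k$, $\mathbf{A}$, $\mathbf{v}$, $\mathbf{u}^\dagger$, $f^\dagger$, $\mathbf{w}$ be as defined in the context. Let $\tilde\xi\in\mathbb{R}^n$ be a noisy data in place of the actual data $\xi$, and for $\lambda>0$ let $\tilde{\mathbf{u}}_\lambda=(\tilde\gamma_1,\ldots,\tilde\gamma_k)\in\mathbb{R}^k$ be the unique solution of $(\mathbf{A}+\lambda\mathbf{I})\tilde{\mathbf{u}}_\lambda=\tilde{\mathbf{v}}$, where $\tilde{\mathbf{v}}=(\tilde\beta_1,\ldots,\tilde\beta_k)$ with $\tilde\beta_\ell=\sum_{i=1}^nw_i\tilde\xi_i\varphi_i(h_\ell)$, and let $\tilde f_\lambda=\sum_{j=1}^k\tilde\gamma_jh_j$. Then $$\|\mathbf{u}^\dagger-\tilde{\mathbf{u}}_\lambda\|_{\mathbb{R}^k}\le\lambda\|\mathbf{w}\|_{\mathbb{R}^k}+\frac{\|\xi-\tilde\xi\|_w}{2\sqrt\lambda},$$ $$\|f^\dagger-\tilde f_\lambda\|_{\mathcal{X}}\le\Big(\sum_{j=1}^k\|h_j\|_{\mathcal{X}}^2\Big)^{1/2}\|\mathbf{u}^\dagger-\tilde{\mathbf{u}}_\lambda\|_{\mathbb{R}^k}$$ for all $\lambda>0$. In particular, if $\|\xi-\tilde\xi\|_w\le\delta$ for some $\delta>0$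 and if $\lambda_\delta=\delta^{2/3}$, then $$\|\mathbf{u}^\dagger-\tilde{\mathbf{u}}_{\lambda_\delta}\|_{\mathbb{R}^k}\le C_1\delta^{2/3},\qquad\|f^\dagger-\tilde f_{\lambda_\delta}\|_{\mathcal{X}}\le C_2\delta^{2/3},$$ where $C_1:=\|\mathbf{w}\|_{\mathbb{R}^k}+1/2$ and $C_2:=C_1\Big(\sum_{j=1}^k\|h_j\|_{\mathcal{X}}^2\Big)^{1/2}$.
   Context: $\mathcal{X}^*$ is the space of continuous linear functionals on $\mathcal{X}$, and $\Phi:\mathcal{X}\to\mathbb{R}^n$ is $\Phi(f)=(\varphi_1(f),\ldots,\varphi_n(f))$. $\mathbb{R}^n$ carries the weighted inner product $\langle\mathbf{u},\mathbf{v}\rangle_w=\sum_{i=1}^nw_i\mathbf{u}_i\mathbf{v}_i$ with norm $\|\mathbf{u}\|_w=(\sum_{i=1}^nw_i|\mathbf{u}_i|^2)^{1/2}$, and $\Phi^*:\mathbb{R}^n\to\mathcal{X}^*$ is defined by $(\Phi^*(\mathbf{u}))(f)=\langle\Phi(f),\mathbf{u}\rangle_w$. The functionals $\psi_1,\ldots,\psi_k\in\mathcal{X}^*$ are linearly independent with $\mathrm{span}\{\psi_1,\ldots,\psi_k\}=\mathrm{span}\{\varphi_1,\ldots,\varphi_n\}$; $h_1,\ldots,h_k\in\mathcal{X}$ satisfy $\psi_i(h_j)=\delta_{ij}$ for $i,j\in\{1,\ldots,k\}$; $\mathcal{X}_0=\mathrm{span}\{h_1,\ldots,h_k\}$. $\mathbf{A}=(a_{\ell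 j})$ is the $k\times k$ real matrix with $a_{\ell j}=\sum_{i=1}^nw_i\varphi_i(h_j)\varphi_i(h_\ell)$, and $\mathbf{v}=(\beta_1,\ldots,\beta_k)\in\mathbb{R}^k$ with $\beta_\ell=\sum_{i=1}^nw_i\xi_i\varphi_i(h_\ell)$. The matrix $\mathbf{A}$ is symmetric positive definite, hence $\mathbf{A}$ and $\mathbf{A}+\lambda\mathbf{I}$ ($\lambda>0$, $\mathbf{I}$ the $k\times k$ identity) are invertible. $\mathbf{u}^\dagger=(\alpha_1,\ldots,\alpha_k)$ is the unique solution of $\mathbf{A}\mathbf{u}=\mathbf{v}$; $f^\dagger=\sum_{j=1}^k\alpha_jh_j$, which is the unique element of $\mathcal{X}_0$ with $\Phi^*\Phi(f^\dagger)=\Phi^*(\xi)$; $\mathbf{w}\in\mathbb{R}^k$ is the unique vector with $\mathbf{u}^\dagger=\mathbf{A}\mathbf{w}$. $\|\cdot\|_{\mathbb{R}^k}$ is the standard Euclidean norm on $\mathbb{R}^k$. *)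

theory Defs
  imports "HOL-Analysis.Analysis"
begin

text \<open>
  Families indexed by \<open>1, \<dots>, n\<close> and \<open>1, \<dots>, k\<close> are functions on finite index types
  \<open>'n\<close> and \<open>'k\<close>. The dual space \<open>X\<^sup>*\<close> is \<open>'a \<Rightarrow>\<^sub>L real\<close>. The
  solutions below are definite descriptions: they exist and are unique because the matrix \<open>A\<close>
  is positive definite when the weights are positive and the functionals \<open>\<phi>\<close> separate
  the points of the span of \<open>h\<close>.
\<close>

definition wnorm :: "('n::finite \<Rightarrow> real) \<Rightarrow> real ^ 'n \<Rightarrow> real" where
  "wnorm w u = sqrt (\<Sum>i\<in>UNIV. w i * \<bar>u $ i\<bar>\<^sup>2)"

definition lin_indep_family :: "('k \<Rightarrow> 'b::real_vector) \<Rightarrow> bool" where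
  "lin_indep_family b \<longleftrightarrow> inj b \<and> independent (range b)"

definition Amat :: "('n::finite \<Rightarrow> real) \<Rightarrow> ('n \<Rightarrow> 'a::real_normed_vector \<Rightarrow>\<^sub>L real)
    \<Rightarrow> ('k::finite \<Rightarrow> 'a) \<Rightarrow> real ^ 'k ^ 'k" where
  "Amat w \<phi> h =
     (\<chi> l j. \<Sum>i\<in>UNIV. w i * blinfun_apply (\<phi> i) (h j) * blinfun_apply (\<phi> i) (h l))"

definition vvec :: "('n::finite \<Rightarrow> real) \<Rightarrow> ('n \<Rightarrow> 'a::real_normed_vector \<Rightarrow>\<^sub>L real)
    \<Rightarrow> ('k::finite \<Rightarrow> 'a) \<Rightarrow> real ^ 'n \<Rightarrow> real ^ 'k" where
  "vvec w \<phi> h \<xi> = (\<chi> l. \<Sum>i\<in>UNIV. w i * \<xi> $ i * blinfun_apply (\<phi> i) (h l))"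

definition lin_comb :: "('k::finite \<Rightarrow> 'a::real_vector) \<Rightarrow> real ^ 'k \<Rightarrow> 'a" where
  "lin_comb h u = (\<Sum>j\<in>UNIV. (u $ j) *\<^sub>R h j)"

definition u_dag :: "('n::finite \<Rightarrow> real) \<Rightarrow> ('n \<Rightarrow> 'a::real_normed_vector \<Rightarrow>\<^sub>L real)
    \<Rightarrow> ('k::finite \<Rightarrow> 'a) \<Rightarrow> real ^ 'n \<Rightarrow> real ^ 'k" where
  "u_dag w \<phi> h \<xi> = (THE u. Amat w \<phi> h *v u = vvec w \<phi> h \<xi>)"

definition f_dag :: "('n::finite \<Rightarrow> real) \<Rightarrow> ('n \<Rightarrow> 'a::real_normed_vector \<Rightarrow>\<^sub>L real)
    \<Rightarrow> ('k::finite \<Rightarrow> 'a) \<Rightarrow> real ^ 'n \<Rightarrow> 'a" where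
  "f_dag w \<phi> h \<xi> = lin_comb h (u_dag w \<phi> h \<xi>)"

text \<open>The vector called \<open>w\<close> (in bold) in the mathematics; \<open>w\<close> here denotes the weights.\<close>

definition source_vec :: "('n::finite \<Rightarrow> real) \<Rightarrow> ('n \<Rightarrow> 'a::real_normed_vector \<Rightarrow>\<^sub>L real)
    \<Rightarrow> ('k::finite \<Rightarrow> 'a) \<Rightarrow> real ^ 'n \<Rightarrow> real ^ 'k" where
  "source_vec w \<phi> h \<xi> = (THE z. u_dag w \<phi> h \<xi> = Amat w \<phi> h *v z)"

definition u_reg :: "('n::finite \<Rightarrow> real) \<Rightarrow> ('n \<Rightarrow> 'a::real_normed_vector \<Rightarrow>\<^sub>L real)
    \<Rightarrow> ('k::finite \<Rightarrow> 'a) \<Rightarrow> real ^ 'n \<Rightarrow> real \<Rightarrow> real ^ 'k" where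
  "u_reg w \<phi> h \<xi> lam = (THE u. (Amat w \<phi> h + lam *\<^sub>R mat 1) *v u = vvec w \<phi> h \<xi>)"

definition f_reg :: "('n::finite \<Rightarrow> real) \<Rightarrow> ('n \<Rightarrow> 'a::real_normed_vector \<Rightarrow>\<^sub>L real)
    \<Rightarrow> ('k::finite \<Rightarrow> 'a) \<Rightarrow> real ^ 'n \<Rightarrow> real \<Rightarrow> 'a" where
  "f_reg w \<phi> h \<xi> lam = lin_comb h (u_reg w \<phi> h \<xi> lam)"

end

theory Submission
  imports Defs
begin

text \<open>
  Write \<open>A\<close> for the Gram matrix, \<open>f\<^sub>u = \<Sum>\<^sub>j u\<^sub>j h\<^sub>j\<close>,
  \<open>z\<close> for the source vector and \<open>\<eta> = \<xi> - \<xi>'\<close>. The matrix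
  \<open>A\<close> represents the form \<open>(u, v) \<mapsto> \<Sum>\<^sub>i w\<^sub>i \<phi>\<^sub>i(f\<^sub>u) \<phi>\<^sub>i(f\<^sub>v)\<close>, so it
  is positive semidefinite. It is injective because the \<open>\<phi>\<^sub>i\<close> span the \<open>\<psi>\<^sub>j\<close>,
  and \<open>\<psi>\<^sub>j\<close> reads off the \<open>j\<close>-th coefficient of \<open>f\<^sub>u\<close>. Hence all the linear
  systems involved have exactly one solution.

  Subtracting the two systems shows that the error \<open>e\<close> satisfies
  \<open>(A + \<lambda>) e = \<lambda> A z + v(\<eta>)\<close>, where \<open>v(\<eta>)\<close> is the right-hand side for the data
  \<open>\<eta>\<close>. The two terms on the right are treated separately, which splits
  \<open>e = a + b\<close> into an approximation error \<open>a\<close> and a propagated noise \<open>b\<close>.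
  Positivity of \<open>A\<close> gives \<open>\<parallel>a\<parallel> \<le> \<lambda> \<parallel>z\<parallel>\<close>
  (\<open>regularized_source_bound\<close>). Testing the equation for \<open>b\<close> with \<open>b\<close> itself
  gives \<open>\<lambda> \<parallel>b\<parallel>\<^sup>2 = \<Sum>\<^sub>i w\<^sub>i (\<eta>\<^sub>i s\<^sub>i - s\<^sub>i\<^sup>2)\<close> with
  \<open>s\<^sub>i = \<phi>\<^sub>i(f\<^sub>b)\<close>, and maximizing each summand over \<open>s\<^sub>i\<close> leaves
  \<open>\<parallel>\<eta>\<parallel>\<^sub>w\<^sup>2 / 4\<close> (\<open>regularized_noise_bound\<close>); this is the origin of the factor
  \<open>1/2\<close>. The choice \<open>\<lambda> = \<delta> powr (2/3)\<close> balances \<open>\<lambda>\<close> against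
  \<open>\<delta> / sqrt \<lambda>\<close>. The estimate in \<open>X\<close> is the Cauchy--Schwarz inequality applied to
  the coefficients.
\<close>

section \<open>Linear combinations and the Gram matrix\<close>

lemma lin_comb_diff: "lin_comb h (u - v) = lin_comb h u - lin_comb h v"
  by (simp add: lin_comb_def scaleR_diff_left sum_subtractf)

lemma norm_lin_comb_le:
  fixes h :: "'k::finite \<Rightarrow> 'a::real_normed_vector"
  shows "norm (lin_comb h u) \<le> sqrt (\<Sum>j\<in>UNIV. (norm (h j))\<^sup>2) * norm u"
proof -
  have "norm (lin_comb h u) \<le> (\<Sum>j\<in>UNIV. \<bar>norm (h j)\<bar> * \<bar>u $ j\<bar>)"
    unfolding lin_comb_def by (rule order_trans[OF norm_sum]) (simp add: mult.commute)
  also have "\<dots> \<le> L2_set (\<lambda>j. norm (h j)) UNIV * L2_set (\<lambda>j. u $ j) UNIV"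
    by (rule L2_set_mult_ineq)
  finally show ?thesis
    by (simp add: L2_set_def norm_vec_def)
qed

lemma blinfun_apply_lin_comb:
  fixes h :: "'k::finite \<Rightarrow> 'a::real_normed_vector" and f :: "'a \<Rightarrow>\<^sub>L real"
  shows "blinfun_apply f (lin_comb h u) = (\<Sum>j\<in>UNIV. u $ j * blinfun_apply f (h j))"
  by (simp add: lin_comb_def blinfun.sum_right blinfun.scaleR_right)

lemma vvec_diff: "vvec w \<phi> h (\<xi> - \<xi>') = vvec w \<phi> h \<xi> - vvec w \<phi> h \<xi>'"
  by (simp add: vvec_def vec_eq_iff algebra_simps sum_subtractf)

lemma inner_vvec:
  "x \<bullet> vvec w \<phi> h \<xi> = (\<Sum>i\<in>UNIV. w i * \<xi> $ i * blinfun_apply (\<phi> i) (lin_comb h x))"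
  by (simp add: inner_vec_def vvec_def blinfun_apply_lin_comb sum_distrib_left)
     (subst sum.swap, simp add: mult_ac)

text \<open>
  Applying \<open>A\<close> to \<open>u\<close> amounts to forming the right-hand side for the noise-free data
  \<open>\<Phi>(f\<^sub>u)\<close>; statements about the form of \<open>A\<close> thereby reduce to \<open>inner_vvec\<close>.
\<close>

lemma Amat_mult_eq_vvec:
  "Amat w \<phi> h *v u = vvec w \<phi> h (\<chi> i. blinfun_apply (\<phi> i) (lin_comb h u))"
proof -
  have "(\<Sum>j\<in>UNIV. (\<Sum>i\<in>UNIV. w i * blinfun_apply (\<phi> i) (h j) * blinfun_apply (\<phi> i) (h l)) * u $ j)
      = (\<Sum>i\<in>UNIV. w i * (\<Sum>j\<in>UNIV. u $ j * blinfun_apply (\<phi> i) (h j)) * blinfun_apply (\<phi> i) (h l))"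
    for l
    unfolding sum_distrib_left sum_distrib_right
    by (subst sum.swap) (simp add: mult_ac)
  then show ?thesis
    by (simp add: Amat_def vvec_def matrix_vector_mult_def vec_eq_iff blinfun_apply_lin_comb)
qed

lemma inner_Amat_self:
  "x \<bullet> (Amat w \<phi> h *v x) = (\<Sum>i\<in>UNIV. w i * (blinfun_apply (\<phi> i) (lin_comb h x))\<^sup>2)"
  by (simp add: Amat_mult_eq_vvec inner_vvec power2_eq_square mult.assoc)

lemma inner_Amat_self_nonneg:
  assumes "\<And>i. w i > 0"
  shows "x \<bullet> (Amat w \<phi> h *v x) \<ge> 0"
  unfolding inner_Amat_self by (intro sum_nonneg mult_nonneg_nonneg) (auto simp: assms less_imp_le)

text \<open>
  A kernel vector \<open>x\<close> has \<open>\<Sum>\<^sub>i w\<^sub>i \<phi>\<^sub>i(f\<^sub>x)\<^sup>2 = 0\<close>, so every \<open>\<phi>\<^sub>i\<close>, and with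
  them every \<open>\<psi>\<^sub>j\<close>, vanishes at \<open>f\<^sub>x\<close>; but \<open>\<psi>\<^sub>j(f\<^sub>x) = x\<^sub>j\<close> by
  biorthogonality.
\<close>

lemma Amat_kernel_trivial:
  fixes \<phi> :: "'n::finite \<Rightarrow> 'a::real_normed_vector \<Rightarrow>\<^sub>L real"
    and \<psi> :: "'k::finite \<Rightarrow> 'a \<Rightarrow>\<^sub>L real"
  assumes w_pos: "\<And>i. w i > 0"
    and \<psi>_span: "range \<psi> \<subseteq> span (range \<phi>)"
    and biorth: "\<And>i j. blinfun_apply (\<psi> i) (h j) = (if i = j then 1 else 0)"
    and zero: "Amat w \<phi> h *v x = 0"
  shows "x = 0"
proof -
  have "(\<Sum>i\<in>UNIV. w i * (blinfun_apply (\<phi> i) (lin_comb h x))\<^sup>2) = 0"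
    using inner_Amat_self[of x w \<phi> h] zero by simp
  then have "\<forall>i. w i * (blinfun_apply (\<phi> i) (lin_comb h x))\<^sup>2 = 0"
    using w_pos by (subst (asm) sum_nonneg_eq_0_iff) (auto simp: less_imp_le)
  then have \<phi>_zero: "blinfun_apply (\<phi> i) (lin_comb h x) = 0" for i
    using w_pos[of i] by (auto simp: less_le)
  have span_zero: "blinfun_apply f (lin_comb h x) = 0" if "f \<in> span (range \<phi>)" for f
    using that
    by (induction rule: span_induct_alt)
       (auto simp: \<phi>_zero blinfun.add_left blinfun.scaleR_left)
  have "x $ i = 0" for i
  proof -
    have "x $ i = blinfun_apply (\<psi> i) (lin_comb h x)"
      by (simp add: blinfun_apply_lin_comb biorth if_distrib cong: if_cong)
    also have "\<dots> = 0"
      using \<psi>_span by (intro span_zero) auto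
    finally show ?thesis .
  qed
  then show ?thesis
    by (simp add: vec_eq_iff)
qed

section \<open>Solvability of the linear systems\<close>

lemma matrix_unique_solution:
  fixes M :: "real ^ 'k ^ 'k"
  assumes "\<And>x. M *v x = 0 \<Longrightarrow> x = 0"
  shows "\<exists>!x. M *v x = b"
proof -
  have inj: "inj ((*v) M)"
    using assms by (simp add: linear_injective_0 matrix_vector_mul_linear)
  then have "surj ((*v) M)"
    by (intro linear_inj_imp_surj matrix_vector_mul_linear)
  with inj show ?thesis
    by (metis injD surjD)
qed

lemma shifted_matrix_vector_mult:
  fixes M :: "real ^ 'k ^ 'k"
  shows "(M + lam *\<^sub>R mat 1) *v x = M *v x + lam *\<^sub>R x"
  by (simp add: matrix_vector_mult_add_rdistrib scaleR_matrix_vector_assoc[symmetric])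

lemma shifted_matrix_kernel_trivial:
  fixes M :: "real ^ 'k ^ 'k"
  assumes psd: "\<And>x. x \<bullet> (M *v x) \<ge> 0" and "lam > 0"
    and zero: "(M + lam *\<^sub>R mat 1) *v x = 0"
  shows "x = 0"
proof -
  have "x \<bullet> (M *v x) + lam * (x \<bullet> x) = x \<bullet> ((M + lam *\<^sub>R mat 1) *v x)"
    by (simp only: shifted_matrix_vector_mult inner_add_right inner_scaleR_right)
  also have "\<dots> = 0"
    by (simp only: zero inner_zero_right)
  finally have "lam * (x \<bullet> x) \<le> 0"
    using psd[of x] by linarith
  then have "x \<bullet> x \<le> 0"
    using \<open>lam > 0\<close> by (simp add: mult_le_0_iff)
  then show ?thesis
    by (simp add: dot_square_norm)
qed

section \<open>Error of the regularized solution\<close>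

text \<open>
  With \<open>c = \<lambda> z - a\<close> the equation becomes \<open>M c = \<lambda> a\<close>, so that
  \<open>\<lambda> (c \<bullet> a) = c \<bullet> M c \<ge> 0\<close>, that is \<open>\<parallel>a\<parallel>\<^sup>2 \<le> \<lambda> (z \<bullet> a)\<close>.
  The Cauchy--Schwarz inequality then yields the bound.
\<close>

lemma regularized_source_bound:
  fixes M :: "real ^ 'k ^ 'k"
  assumes psd: "\<And>x. x \<bullet> (M *v x) \<ge> 0" and "lam > 0"
    and eq: "(M + lam *\<^sub>R mat 1) *v a = lam *\<^sub>R (M *v z)"
  shows "norm a \<le> lam * norm z"
proof -
  let ?c = "lam *\<^sub>R z - a"
  have "M *v ?c = lam *\<^sub>R (M *v z) - M *v a"
    by (simp add: matrix_vector_mult_diff_distrib matrix_vector_mult_scaleR)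
  also have "\<dots> = lam *\<^sub>R a"
    using eq unfolding shifted_matrix_vector_mult by (simp add: algebra_simps)
  finally have "lam * (?c \<bullet> a) \<ge> 0"
    using psd[of ?c] by simp
  then have "?c \<bullet> a \<ge> 0"
    using \<open>lam > 0\<close> by (simp add: zero_le_mult_iff)
  then have "a \<bullet> a \<le> lam * (z \<bullet> a)"
    by (simp add: inner_diff_left)
  also have "\<dots> \<le> lam * (norm z * norm a)"
    using \<open>lam > 0\<close> norm_cauchy_schwarz[of z a] by simp
  finally have "norm a * norm a \<le> (lam * norm z) * norm a"
    by (simp add: dot_square_norm power2_eq_square mult.assoc)
  then show ?thesis
    using \<open>lam > 0\<close> by (cases "norm a = 0") (auto simp: mult_le_cancel_right)
qed

text \<open>
  Pairing the equation with \<open>b\<close> puts \<open>\<Sum>\<^sub>i w\<^sub>i s\<^sub>i\<^sup>2\<close>, the value of the form of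
  \<open>A\<close> at \<open>b\<close>, on the left. This term is kept, because it absorbs the samples \<open>s\<^sub>i\<close>
  on the right by completing the square; what remains is independent of the size of \<open>A\<close>.
\<close>

lemma regularized_noise_bound:
  assumes w_pos: "\<And>i. w i > 0" and "lam > 0"
    and eq: "(Amat w \<phi> h + lam *\<^sub>R mat 1) *v b = vvec w \<phi> h \<eta>"
  shows "norm b \<le> wnorm w \<eta> / (2 * sqrt lam)"
proof -
  define s where "s i = blinfun_apply (\<phi> i) (lin_comb h b)" for i
  have "b \<bullet> vvec w \<phi> h \<eta> = b \<bullet> (Amat w \<phi> h *v b) + lam * (b \<bullet> b)"
    by (simp only: eq[symmetric] shifted_matrix_vector_mult inner_add_right inner_scaleR_right)
  then have "lam * (norm b)\<^sup>2 = (\<Sum>i\<in>UNIV. w i * (\<eta> $ i * s i - (s i)\<^sup>2))"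
    by (simp add: inner_vvec inner_Amat_self s_def dot_square_norm algebra_simps sum_subtractf)
  also have "\<dots> \<le> (\<Sum>i\<in>UNIV. w i * ((\<eta> $ i)\<^sup>2 / 4))"
  proof (intro sum_mono mult_left_mono)
    fix i
    have "0 \<le> (\<eta> $ i / 2 - s i)\<^sup>2"
      by simp
    then show "\<eta> $ i * s i - (s i)\<^sup>2 \<le> (\<eta> $ i)\<^sup>2 / 4"
      by (simp add: power2_eq_square algebra_simps)
  qed (simp add: w_pos less_imp_le)
  also have "\<dots> = (wnorm w \<eta>)\<^sup>2 / 4"
    by (simp add: wnorm_def sum_nonneg w_pos less_imp_le sum_divide_distrib)
  finally have "(norm b)\<^sup>2 \<le> (wnorm w \<eta> / (2 * sqrt lam))\<^sup>2"
    using \<open>lam > 0\<close> by (simp add: power_divide power_mult_distrib field_simps)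
  moreover have "0 \<le> wnorm w \<eta> / (2 * sqrt lam)"
    using \<open>lam > 0\<close> by (simp add: wnorm_def sum_nonneg w_pos less_imp_le)
  ultimately show ?thesis
    by (rule power2_le_imp_le)
qed

lemma regularized_solution_error:
  fixes \<phi> :: "'n::finite \<Rightarrow> 'a::real_normed_vector \<Rightarrow>\<^sub>L real" and h :: "'k::finite \<Rightarrow> 'a"
  assumes w_pos: "\<And>i. w i > 0" and "lam > 0"
    and inj: "\<And>x. Amat w \<phi> h *v x = 0 \<Longrightarrow> x = 0"
  shows "norm (u_dag w \<phi> h \<xi> - u_reg w \<phi> h \<xi>' lam)
           \<le> lam * norm (source_vec w \<phi> h \<xi>) + wnorm w (\<xi> - \<xi>') / (2 * sqrt lam)"
proof -
  let ?A = "Amat w \<phi> h"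
  let ?B = "?A + lam *\<^sub>R mat 1"
  define u where "u = u_dag w \<phi> h \<xi>"
  define u' where "u' = u_reg w \<phi> h \<xi>' lam"
  define z where "z = source_vec w \<phi> h \<xi>"
  have psd: "x \<bullet> (?A *v x) \<ge> 0" for x
    by (rule inner_Amat_self_nonneg[OF w_pos])
  have B_inj: "x = 0" if "?B *v x = 0" for x
    using shifted_matrix_kernel_trivial[OF psd \<open>lam > 0\<close> that] .
  have u: "?A *v u = vvec w \<phi> h \<xi>"
    unfolding u_def u_dag_def by (rule theI'[OF matrix_unique_solution[OF inj]])
  have "?A *v z = u_dag w \<phi> h \<xi>"
    unfolding z_def source_vec_def eq_commute[of "u_dag w \<phi> h \<xi>"]
    by (rule theI'[OF matrix_unique_solution[OF inj]])
  then have z: "u = ?A *v z"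
    by (simp add: u_def)
  have u': "?B *v u' = vvec w \<phi> h \<xi>'"
    unfolding u'_def u_reg_def by (rule theI'[OF matrix_unique_solution[OF B_inj]])
  obtain a where a: "?B *v a = lam *\<^sub>R (?A *v z)"
    using matrix_unique_solution[OF B_inj] by blast
  \<comment> \<open>The noise part is the remainder, so that only its equation has to be checked.\<close>
  define b where "b = u - u' - a"
  have "?B *v b = ?B *v u - ?B *v u' - ?B *v a"
    by (simp only: b_def matrix_vector_mult_diff_distrib)
  also have "\<dots> = (vvec w \<phi> h \<xi> + lam *\<^sub>R u) - vvec w \<phi> h \<xi>' - lam *\<^sub>R u"
    by (simp only: u' a shifted_matrix_vector_mult[of _ _ u] u z[symmetric])
  also have "\<dots> = vvec w \<phi> h (\<xi> - \<xi>')"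
    by (simp add: vvec_diff)
  finally have "norm b \<le> wnorm w (\<xi> - \<xi>') / (2 * sqrt lam)"
    by (rule regularized_noise_bound[OF w_pos \<open>lam > 0\<close>])
  moreover have "norm a \<le> lam * norm z"
    by (rule regularized_source_bound[OF psd \<open>lam > 0\<close> a])
  moreover have "norm (u - u') \<le> norm a + norm b"
    using norm_triangle_ineq[of a b] by (simp add: b_def)
  ultimately show ?thesis
    unfolding u_def u'_def z_def by linarith
qed

theorem theorem6p3:
  fixes \<phi> :: "'n::finite \<Rightarrow> 'a::real_normed_vector \<Rightarrow>\<^sub>L real"
    and \<psi> :: "'k::finite \<Rightarrow> 'a \<Rightarrow>\<^sub>L real"
    and h :: "'k \<Rightarrow> 'a"
    and w :: "'n \<Rightarrow> real"
    and \<xi> \<xi>' :: "real ^ 'n"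
  assumes w_pos: "\<And>i. w i > 0"
    and \<psi>_indep: "lin_indep_family \<psi>"
    and \<psi>_span: "span (range \<psi>) = span (range \<phi>)"
    and biorth: "\<And>i j. blinfun_apply (\<psi> i) (h j) = (if i = j then 1 else 0)"
  shows "(\<forall>lam>0.
            norm (u_dag w \<phi> h \<xi> - u_reg w \<phi> h \<xi>' lam)
              \<le> lam * norm (source_vec w \<phi> h \<xi>) + wnorm w (\<xi> - \<xi>') / (2 * sqrt lam)
          \<and> norm (f_dag w \<phi> h \<xi> - f_reg w \<phi> h \<xi>' lam)
              \<le> sqrt (\<Sum>j\<in>UNIV. (norm (h j))\<^sup>2)
                 * norm (u_dag w \<phi> h \<xi> - u_reg w \<phi> h \<xi>' lam))
       \<and> (\<forall>\<delta>>0. wnorm w (\<xi> - \<xi>') \<le> \<delta> \<longrightarrow>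
            (let lam_d = \<delta> powr (2/3);
                 C1 = norm (source_vec w \<phi> h \<xi>) + 1/2;
                 C2 = C1 * sqrt (\<Sum>j\<in>UNIV. (norm (h j))\<^sup>2)
             in norm (u_dag w \<phi> h \<xi> - u_reg w \<phi> h \<xi>' lam_d) \<le> C1 * \<delta> powr (2/3)
              \<and> norm (f_dag w \<phi> h \<xi> - f_reg w \<phi> h \<xi>' lam_d) \<le> C2 * \<delta> powr (2/3)))"
proof -
  let ?H = "sqrt (\<Sum>j\<in>UNIV. (norm (h j))\<^sup>2)"
  let ?z = "norm (source_vec w \<phi> h \<xi>)"
  let ?e = "\<lambda>lam. norm (u_dag w \<phi> h \<xi> - u_reg w \<phi> h \<xi>' lam)"
  have "range \<psi> \<subseteq> span (range \<phi>)"
    unfolding \<psi>_span[symmetric] by (rule span_superset)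
  then have inj: "x = 0" if "Amat w \<phi> h *v x = 0" for x
    by (rule Amat_kernel_trivial[OF w_pos _ biorth that])
  have u_error: "?e lam \<le> lam * ?z + wnorm w (\<xi> - \<xi>') / (2 * sqrt lam)" if "lam > 0" for lam
    by (rule regularized_solution_error[OF w_pos that inj])
  have f_error: "norm (f_dag w \<phi> h \<xi> - f_reg w \<phi> h \<xi>' lam) \<le> ?H * ?e lam" for lam
    unfolding f_dag_def f_reg_def lin_comb_diff[symmetric] by (rule norm_lin_comb_le)
  have u_rate: "?e (\<delta> powr (2/3)) \<le> (?z + 1/2) * \<delta> powr (2/3)"
    if "\<delta> > 0" and noise: "wnorm w (\<xi> - \<xi>') \<le> \<delta>" for \<delta>
  proof -
    let ?l = "\<delta> powr (2/3)"
    \<comment> \<open>\<open>\<delta> / sqrt (\<delta> powr (2/3)) = \<delta> powr (1 - 1/3)\<close>, the same power as the first term\<close>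
    have sqrt_l: "sqrt ?l = \<delta> powr (1/3)"
      using \<open>\<delta> > 0\<close> by (simp add: powr_half_sqrt[symmetric] powr_powr)
    have "?l * \<delta> powr (1/3) = \<delta>"
      using \<open>\<delta> > 0\<close> by (simp add: powr_add[symmetric])
    then have balance: "\<delta> / (2 * sqrt ?l) = ?l / 2"
      unfolding sqrt_l using \<open>\<delta> > 0\<close> by (simp add: field_simps)
    have "?e ?l \<le> ?l * ?z + wnorm w (\<xi> - \<xi>') / (2 * sqrt ?l)"
      using \<open>\<delta> > 0\<close> by (intro u_error) simp
    also have "\<dots> \<le> ?l * ?z + \<delta> / (2 * sqrt ?l)"
      using noise \<open>\<delta> > 0\<close> by (intro add_left_mono divide_right_mono) auto
    also have "\<dots> = (?z + 1/2) * ?l"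
      unfolding balance by (simp add: algebra_simps)
    finally show ?thesis .
  qed
  have f_rate: "norm (f_dag w \<phi> h \<xi> - f_reg w \<phi> h \<xi>' (\<delta> powr (2/3)))
      \<le> ((?z + 1/2) * ?H) * \<delta> powr (2/3)"
    if "\<delta> > 0" and "wnorm w (\<xi> - \<xi>') \<le> \<delta>" for \<delta>
  proof -
    have "?H * ?e (\<delta> powr (2/3)) \<le> ?H * ((?z + 1/2) * \<delta> powr (2/3))"
      by (rule mult_left_mono[OF u_rate[OF that]]) (simp add: sum_nonneg)
    with f_error[of "\<delta> powr (2/3)"] show ?thesis
      by (simp add: mult_ac)
  qed
  show ?thesis
    unfolding Let_def using u_error f_error u_rate f_rate by blast
qed

end
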